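(* Let $q\in\mathbb{C}$ with $|q|=1$. Then the $\mathbb{Z}_2$-graded quantum Weyl algebra ${\cal W}_q(2|1)$ is a $\mathbb{Z}_2$-graded $*$-algebra, with the involution determined by $$x^*=x,\quad y^*=y,\quad \theta^*=-\theta,\quad \partial_x^*=-q^{-2}\partial_x,\quad \partial_y^*=-q^{-4}\partial_y,\quad \partial_\theta^*=q^{-4}\partial_\theta.$$
   Context: ${\cal W}_q(2|1)$ is the unital associative $\mathbb{C}$-algebra generated by $x,y,\partial_x,\partial_y$ (even) and $\theta,\partial_\theta$ (odd) with relations $xy=yx$, $x\theta=q\theta x$, $y\theta=q\theta y$, $\theta^2=0$; $\partial_x x=1+q^{-2}x\partial_x$, $\partial_y x=q^{-2}x\partial_y$, $\partial_\theta x=q^{-1}x\partial_\theta$, $\partial_y y=1+q^{-2}y\partial_y+(q^{-2}-1)x\partial_x$, $\partial_x y=y\partial_x$, $\partial_\theta y=q^{-1}y\partial_\theta$, $\partial_\theta\theta=1-\theta\partial_\theta+(q^{-2}-1)(x\partial_x+y\partial_y)$, $\partial_x\theta=q^{-1}\theta\partial_x$, $\partial_y\theta=q^{-1}\theta\partial_y$; $\partial_x\partial_y=q^{-2}\partial_y\partial_x$, $\partial_x\partial_\theta=q^{-1}\partial_\theta\partial_x$, $\partial_y\partial_\theta=q^{-1}\partial_\theta\partial_y$, $\partial_\theta^2=0$. A $\mathbb{Z}_2$-graded $*$-algebra is a $\mathbb{Z}_2$-graded algebra with a conjugate-linear map $*$ such that $(ab)^*=(-1)^{p(a)p(b)}b^*a^*$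 for homogeneous $a,b$ ($p$ = parity) and $(a^* )^*=a$. *)

theory Defs
  imports "HOL-Algebra.Algebra" "HOL-Algebra.Algebraic_Closure_Type"
    "HOL-Library.Poly_Mapping" "HOL-Library.Z2" "HOL-Library.FuncSet"
begin

text \<open>Associative unital, not necessarily commutative, algebras; the locale
  \<^locale>\<open>algebra\<close> of HOL-Algebra is restricted to commutative ones.\<close>

locale complex_algebra = module "ring_of_type_algebra :: complex ring" A + ring A
  for A :: "(complex, 'a, 'm) module_scheme" (structure) +
  assumes smult_mult_left:
    "\<lbrakk>a \<in> carrier A; b \<in> carrier A\<rbrakk> \<Longrightarrow>
      (c \<odot>\<^bsub>A\<^esub> a) \<otimes>\<^bsub>A\<^esub> b = c \<odot>\<^bsub>A\<^esub> (a \<otimes>\<^bsub>A\<^esub> b)"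
    and smult_mult_right:
    "\<lbrakk>a \<in> carrier A; b \<in> carrier A\<rbrakk> \<Longrightarrow>
      a \<otimes>\<^bsub>A\<^esub> (c \<odot>\<^bsub>A\<^esub> b) = c \<odot>\<^bsub>A\<^esub> (a \<otimes>\<^bsub>A\<^esub> b)"

locale Z2_graded_algebra = complex_algebra A
  for A :: "(complex, 'a, 'm) module_scheme" (structure) +
  fixes gr :: "bit \<Rightarrow> 'a set"
  assumes gr_submodule: "submodule (gr i) (ring_of_type_algebra :: complex ring) A"
    and gr_direct_sum: "a \<in> carrier A \<Longrightarrow>
      \<exists>!(u, v). u \<in> gr 0 \<and> v \<in> gr 1 \<and> a = u \<oplus>\<^bsub>A\<^esub> v"
    and gr_mult: "\<lbrakk>a \<in> gr i; b \<in> gr j\<rbrakk> \<Longrightarrow> a \<otimes>\<^bsub>A\<^esub> b \<in> gr (i + j)"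

locale Z2_graded_star_algebra = Z2_graded_algebra A gr
  for A :: "(complex, 'a, 'm) module_scheme" (structure)
    and gr :: "bit \<Rightarrow> 'a set" +
  fixes star :: "'a \<Rightarrow> 'a"
  assumes star_closed: "a \<in> carrier A \<Longrightarrow> star a \<in> carrier A"
    and star_add: "\<lbrakk>a \<in> carrier A; b \<in> carrier A\<rbrakk> \<Longrightarrow>
      star (a \<oplus>\<^bsub>A\<^esub> b) = star a \<oplus>\<^bsub>A\<^esub> star b"
    and star_smult: "a \<in> carrier A \<Longrightarrow> star (c \<odot>\<^bsub>A\<^esub> a) = cnj c \<odot>\<^bsub>A\<^esub> star a"
    and star_mult: "\<lbrakk>a \<in> gr i; b \<in> gr j\<rbrakk> \<Longrightarrow>
      star (a \<otimes>\<^bsub>A\<^esub> b) =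
        (if i = 1 \<and> j = 1 then -1 else 1) \<odot>\<^bsub>A\<^esub> (star b \<otimes>\<^bsub>A\<^esub> star a)"
    and star_star: "a \<in> carrier A \<Longrightarrow> star (star a) = a"

text \<open>Words form the free monoid, written additively because the convolution product of
  \<open>\<Rightarrow>\<^sub>0\<close> is taken with respect to the additive structure of the index type. The finitely
  supported functions on words then form the free associative unital algebra.\<close>

datatype 'g free_word = Free_Word (letters: "'g list")

instantiation free_word :: (type) monoid_add
begin

definition zero_free_word :: "'g free_word" where
  "zero_free_word = Free_Word []"

definition plus_free_word :: "'g free_word \<Rightarrow> 'g free_word \<Rightarrow> 'g free_word" where
  "plus_free_word u v = Free_Word (letters u @ letters v)"

instance
  by standard (simp_all add: zero_free_word_def plus_free_word_def)

end

type_synonym 'g free_algebra = "'g free_word \<Rightarrow>\<^sub>0 complex"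

definition free_var :: "'g \<Rightarrow> 'g free_algebra" where
  "free_var g = Poly_Mapping.single (Free_Word [g]) 1"

definition free_const :: "complex \<Rightarrow> 'g free_algebra" where
  "free_const c = Poly_Mapping.single 0 c"

datatype weyl_gen = Gx | Gy | Gtheta | Gdx | Gdy | Gdtheta

definition gen_parity :: "weyl_gen \<Rightarrow> bit" where
  "gen_parity g = (if g = Gtheta \<or> g = Gdtheta then 1 else 0)"

definition word_parity :: "weyl_gen free_word \<Rightarrow> bit" where
  "word_parity w = sum_list (map gen_parity (letters w))"

text \<open>A pair \<open>(l, r)\<close> stands for the defining relation \<open>l = r\<close>.\<close>

definition weyl_relations :: "complex \<Rightarrow> (weyl_gen free_algebra \<times> weyl_gen free_algebra) set" where
  "weyl_relations q =
    (let x = free_var Gx; y = free_var Gy; \<theta> = free_var Gtheta;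
         dx = free_var Gdx; dy = free_var Gdy; d\<theta> = free_var Gdtheta;
         k = free_const
     in {(x * y, y * x),
         (x * \<theta>, k q * \<theta> * x),
         (y * \<theta>, k q * \<theta> * y),
         (\<theta> * \<theta>, 0),
         (dx * x, 1 + k (q powi -2) * x * dx),
         (dy * x, k (q powi -2) * x * dy),
         (d\<theta> * x, k (q powi -1) * x * d\<theta>),
         (dy * y, 1 + k (q powi -2) * y * dy + k (q powi -2 - 1) * x * dx),
         (dx * y, y * dx),
         (d\<theta> * y, k (q powi -1) * y * d\<theta>),
         (d\<theta> * \<theta>, 1 - \<theta> * d\<theta> + k (q powi -2 - 1) * (x * dx + y * dy)),
         (dx * \<theta>, k (q powi -1) * \<theta> * dx),
         (dy * \<theta>, k (q powi -1) * \<theta> * dy),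
         (dx * dy, k (q powi -2) * dy * dx),
         (dx * d\<theta>, k (q powi -1) * d\<theta> * dx),
         (dy * d\<theta>, k (q powi -1) * d\<theta> * dy),
         (d\<theta> * d\<theta>, 0)})"

definition weyl_ideal :: "complex \<Rightarrow> weyl_gen free_algebra set" where
  "weyl_ideal q = Idl\<^bsub>ring_of_type_algebra\<^esub> {l - r | l r. (l, r) \<in> weyl_relations q}"

definition weyl_class :: "complex \<Rightarrow> weyl_gen free_algebra \<Rightarrow> weyl_gen free_algebra set" where
  "weyl_class q f = weyl_ideal q +>\<^bsub>ring_of_type_algebra\<^esub> f"

definition weyl_algebra :: "complex \<Rightarrow> (complex, weyl_gen free_algebra set) module" where
  "weyl_algebra q =
    (let Q = ring_of_type_algebra Quot weyl_ideal q
     in \<lparr>carrier = carrier Q, monoid.mult = monoid.mult Q, one = one Q,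
         ring.zero = ring.zero Q, add = add Q,
         module.smult = (\<lambda>c a. weyl_class q (free_const c) \<otimes>\<^bsub>Q\<^esub> a)\<rparr>)"

definition weyl_grading :: "complex \<Rightarrow> bit \<Rightarrow> weyl_gen free_algebra set set" where
  "weyl_grading q i =
    weyl_class q ` {f. \<forall>w \<in> Poly_Mapping.keys f. word_parity w = i}"

definition weyl_var :: "complex \<Rightarrow> weyl_gen \<Rightarrow> weyl_gen free_algebra set" where
  "weyl_var q g = weyl_class q (free_var g)"

end

theory Submission
  imports Defs
begin

text \<open>
  Multiplying a graded involution by \<open>\<i>\<close> on the odd part turns it into an ordinary conjugate-linear
  antihomomorphism. On the free algebra such an antihomomorphism \<open>\<phi>\<close> is determined by its values on
  the generators. If \<open>|q| = 1\<close>, it sends the difference of the two sides of every relation to a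
  combination of that same difference and of those for \<open>\<partial>\<^sub>x x\<close> and \<open>\<partial>\<^sub>y y\<close>, hence it preserves
  the ideal of relations. The relations are homogeneous, so the parity automorphism
  \<open>\<sigma>\<close> preserves that ideal as well; this gives the grading of the quotient, and
  \<open>\<phi> \<circ> ((1 + \<i>) / 2 + (1 - \<i>) / 2 \<sigma>)\<close> descends to the desired involution.
\<close>

section \<open>Semilinear maps on finitely supported functions\<close>

lemma poly_mapping_single_add_induct [case_names single add]:
  fixes f :: "'a \<Rightarrow>\<^sub>0 'b::comm_monoid_add"
  assumes single: "\<And>w c. P (Poly_Mapping.single w c)"
    and add: "\<And>f g. P f \<Longrightarrow> P g \<Longrightarrow> P (f + g)"
  shows "P f"
proof (induction "card (Poly_Mapping.keys f)" arbitrary: f)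
  case 0
  \<comment> \<open>Zero is a single term with coefficient 0 at an arbitrary index, so the case
    \<open>single\<close> also covers it and the rule has no separate zero case.\<close>
  then have "f = Poly_Mapping.single undefined 0"
    by simp
  then show ?case
    using single by metis
next
  case (Suc n)
  then obtain w where w: "w \<in> Poly_Mapping.keys f"
    by fastforce
  define g where "g = Poly_Mapping.mapp (\<lambda>v c. c when v \<noteq> w) f"
  have lookup_g: "Poly_Mapping.lookup g v = (Poly_Mapping.lookup f v when v \<noteq> w)" for v
    unfolding g_def by (simp add: lookup_mapp when_def in_keys_iff)
  have "f = Poly_Mapping.single w (Poly_Mapping.lookup f w) + g"
    by (rule poly_mapping_eqI) (simp add: lookup_add lookup_g lookup_single when_def)
  moreover have "Poly_Mapping.keys g = Poly_Mapping.keys f - {w}"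
    by (auto simp: in_keys_iff lookup_g when_def split: if_splits)
  then have "P g"
    using Suc w by simp
  ultimately show ?case
    using single add by metis
qed

text \<open>The \<open>\<kappa>\<close>-semilinear map that sends the basis element \<open>w\<close>
  to \<open>h w\<close> times the basis element \<open>\<pi> w\<close>. One construction serves the
  parity automorphism and its square root (identity for \<open>\<kappa>\<close> and
  \<open>\<pi>\<close>) as well as the conjugate-linear antihomomorphism (conjugation and word
  reversal).\<close>

definition twist ::
  "('b::comm_ring_1 \<Rightarrow> 'b) \<Rightarrow> ('a \<Rightarrow> 'b) \<Rightarrow> ('a \<Rightarrow> 'a) \<Rightarrow> ('a \<Rightarrow>\<^sub>0 'b) \<Rightarrow> ('a \<Rightarrow>\<^sub>0 'b)"
  where "twist \<kappa> h \<pi> f =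
    (\<Sum>w\<in>Poly_Mapping.keys f. Poly_Mapping.single (\<pi> w) (h w * \<kappa> (Poly_Mapping.lookup f w)))"

locale twisting = Modules.additive \<kappa> for \<kappa> :: "'b::comm_ring_1 \<Rightarrow> 'b" +
  assumes \<kappa>_mult: "\<kappa> (a * b) = \<kappa> a * \<kappa> b"
begin

lemma twist_single: "twist \<kappa> h \<pi> (Poly_Mapping.single w c) = Poly_Mapping.single (\<pi> w) (h w * \<kappa> c)"
  by (cases "c = 0") (simp_all add: twist_def zero)

text \<open>Terms outside the support vanish because \<open>\<kappa>\<close> maps 0 to 0. The
  freedom in \<open>S\<close> lets \<open>f\<close>, \<open>g\<close> and \<open>f + g\<close> be
  summed over one common index set in the proof of additivity.\<close>

lemma twist_superset:
  assumes "finite S" "Poly_Mapping.keys f \<subseteq> S"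
  shows "twist \<kappa> h \<pi> f = (\<Sum>w\<in>S. Poly_Mapping.single (\<pi> w) (h w * \<kappa> (Poly_Mapping.lookup f w)))"
  unfolding twist_def
  by (rule sum.mono_neutral_left) (use assms in \<open>auto simp: in_keys_iff zero\<close>)

lemma twist_add: "twist \<kappa> h \<pi> (f + g) = twist \<kappa> h \<pi> f + twist \<kappa> h \<pi> g"
proof -
  let ?S = "Poly_Mapping.keys f \<union> Poly_Mapping.keys g"
  have "Poly_Mapping.keys (f + g) \<subseteq> ?S"
    by (rule keys_add)
  then show ?thesis
    by (simp add: twist_superset[where S = ?S] lookup_add add single_add
        distrib_left sum.distrib)
qed

sublocale twist: Modules.additive "twist \<kappa> h \<pi>"
  by unfold_locales (rule twist_add)

text \<open>Both sides are additive in \<open>f\<close> and in \<open>g\<close>, so two single terms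
  suffice; there the claim is the multiplicativity of \<open>\<pi>\<close>, \<open>h\<close> and
  \<open>\<kappa>\<close>. The order-reversing version below has the same proof.\<close>

lemma twist_mult:
  fixes f g :: "'a::monoid_add \<Rightarrow>\<^sub>0 'b"
  assumes "\<And>v w. \<pi> (v + w) = \<pi> v + \<pi> w" "\<And>v w. h (v + w) = h v * h w"
  shows "twist \<kappa> h \<pi> (f * g) = twist \<kappa> h \<pi> f * twist \<kappa> h \<pi> g"
proof (induction f rule: poly_mapping_single_add_induct)
  case (single v c)
  show ?case
    by (induction g rule: poly_mapping_single_add_induct)
      (simp_all add: twist_single mult_single assms \<kappa>_mult twist_add distrib_left mult_ac)
qed (simp add: twist_add distrib_right)

lemma twist_mult_rev:
  fixes f g :: "'a::monoid_add \<Rightarrow>\<^sub>0 'b"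
  assumes "\<And>v w. \<pi> (v + w) = \<pi> w + \<pi> v" "\<And>v w. h (v + w) = h v * h w"
  shows "twist \<kappa> h \<pi> (f * g) = twist \<kappa> h \<pi> g * twist \<kappa> h \<pi> f"
proof (induction f rule: poly_mapping_single_add_induct)
  case (single v c)
  show ?case
    by (induction g rule: poly_mapping_single_add_induct)
      (simp_all add: twist_single mult_single assms \<kappa>_mult twist_add distrib_left distrib_right mult_ac)
qed (simp add: twist_add distrib_left distrib_right)

end

interpretation cnj: twisting cnj
  by unfold_locales simp_all

interpretation ident: twisting "\<lambda>c :: complex. c"
  by unfold_locales simp_all

section \<open>The ideal of relations and the quotient algebra\<close>

lemma ring_free_algebra: "ring (ring_of_type_algebra :: 'g free_algebra ring)"
proof -
  have "\<exists>y. x + y = 0" for x :: "'g free_algebra"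
    using add.right_inverse by blast
  then show ?thesis
    unfolding ring_of_type_algebra_def using add.right_inverse
    by unfold_locales (auto simp: algebra_simps Units_def)
qed

lemma ideal_weyl_ideal: "ideal (weyl_ideal q) ring_of_type_algebra"
  unfolding weyl_ideal_def
  by (rule ring.genideal_ideal[OF ring_free_algebra]) (simp add: ring_of_type_algebra_def)

lemma weyl_relation_mem: "(l, r) \<in> weyl_relations q \<Longrightarrow> l - r \<in> weyl_ideal q"
  unfolding weyl_ideal_def
  using ring.genideal_self[OF ring_free_algebra, of "{l - r | l r. (l, r) \<in> weyl_relations q}"]
  by (auto simp: ring_of_type_algebra_def)

lemma weyl_ideal_zero: "0 \<in> weyl_ideal q"
  using additive_subgroup.zero_closed[OF ideal.axioms(1)[OF ideal_weyl_ideal]]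
  by (simp add: ring_of_type_algebra_def)

lemma weyl_ideal_add: "f \<in> weyl_ideal q \<Longrightarrow> g \<in> weyl_ideal q \<Longrightarrow> f + g \<in> weyl_ideal q"
  using additive_subgroup.a_closed[OF ideal.axioms(1)[OF ideal_weyl_ideal], of f q g]
  by (simp add: ring_of_type_algebra_def)

lemma weyl_ideal_mult_left: "f \<in> weyl_ideal q \<Longrightarrow> g * f \<in> weyl_ideal q"
  using ideal.I_l_closed[OF ideal_weyl_ideal, of f q g]
  by (simp add: ring_of_type_algebra_def)

lemma weyl_ideal_mult_right: "f \<in> weyl_ideal q \<Longrightarrow> f * g \<in> weyl_ideal q"
  using ideal.I_r_closed[OF ideal_weyl_ideal, of f q g]
  by (simp add: ring_of_type_algebra_def)

lemma weyl_ideal_uminus: "f \<in> weyl_ideal q \<Longrightarrow> - f \<in> weyl_ideal q"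
  using weyl_ideal_mult_left[of f q "- 1"] by simp

lemma weyl_ideal_diff: "f \<in> weyl_ideal q \<Longrightarrow> g \<in> weyl_ideal q \<Longrightarrow> f - g \<in> weyl_ideal q"
  using weyl_ideal_add[of f q "- g"] weyl_ideal_uminus by simp

text \<open>Meant for \<open>J\<close> the preimage of the ideal under an additive map that
  preserves or reverses products: stability of the ideal then reduces to a check on the defining
  relations.\<close>

lemma weyl_ideal_least:
  assumes "0 \<in> J" "\<And>f g. f \<in> J \<Longrightarrow> g \<in> J \<Longrightarrow> f + g \<in> J"
    and mult: "\<And>f g. f \<in> J \<Longrightarrow> g * f \<in> J" "\<And>f g. f \<in> J \<Longrightarrow> f * g \<in> J"
    and rel: "\<And>l r. (l, r) \<in> weyl_relations q \<Longrightarrow> l - r \<in> J"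
  shows "weyl_ideal q \<subseteq> J"
proof -
  interpret R: ring "ring_of_type_algebra :: weyl_gen free_algebra ring"
    by (rule ring_free_algebra)
  have inv: "\<ominus>\<^bsub>ring_of_type_algebra\<^esub> f = - f" for f :: "weyl_gen free_algebra"
    by (rule R.minus_equality) (simp_all add: ring_of_type_algebra_def)
  \<comment> \<open>Closure under negation is the absorption of the factor
    \<open>- 1\<close>.\<close>
  have "subgroup J (add_monoid (ring_of_type_algebra :: weyl_gen free_algebra ring))"
    by (rule R.add.subgroupI)
      (use assms(1,2) mult(1)[where g = "- 1"] in
        \<open>auto simp: inv simp flip: a_inv_def, auto simp: ring_of_type_algebra_def\<close>)
  then have "ideal J ring_of_type_algebra"
    by (rule idealI[OF ring_free_algebra]) (simp_all add: mult ring_of_type_algebra_def)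
  then show ?thesis
    unfolding weyl_ideal_def using rel by (intro R.genideal_minimal) auto
qed

lemma weyl_class_eq: "weyl_class q f = (\<lambda>i. i + f) ` weyl_ideal q"
  by (auto simp: weyl_class_def a_r_coset_def r_coset_def ring_of_type_algebra_def)

lemma weyl_class_eq_iff: "weyl_class q f = weyl_class q g \<longleftrightarrow> f - g \<in> weyl_ideal q"
proof
  assume "weyl_class q f = weyl_class q g"
  moreover have "f \<in> weyl_class q f"
    unfolding weyl_class_eq using weyl_ideal_zero by force
  ultimately obtain i where "i \<in> weyl_ideal q" "f = i + g"
    unfolding weyl_class_eq by blast
  then show "f - g \<in> weyl_ideal q"
    by simp
next
  have *: "weyl_class q f \<subseteq> weyl_class q g" if "f - g \<in> weyl_ideal q" for f g
  proof
    fix u assume "u \<in> weyl_class q f"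
    then obtain i where "i \<in> weyl_ideal q" "u = i + f"
      by (auto simp: weyl_class_eq)
    then have "u = (i + (f - g)) + g" "i + (f - g) \<in> weyl_ideal q"
      using that weyl_ideal_add by auto
    then show "u \<in> weyl_class q g"
      unfolding weyl_class_eq by blast
  qed
  assume "f - g \<in> weyl_ideal q"
  then show "weyl_class q f = weyl_class q g"
    using *[of f g] *[of g f] weyl_ideal_uminus[of "f - g" q] by auto
qed

lemma carrier_weyl_algebra: "carrier (weyl_algebra q) = range (weyl_class q)"
  by (auto simp: weyl_algebra_def FactRing_def A_RCOSETS_def RCOSETS_def weyl_class_def
      a_r_coset_def ring_of_type_algebra_def)

lemma weyl_class_mult:
  "weyl_class q f \<otimes>\<^bsub>weyl_algebra q\<^esub> weyl_class q g = weyl_class q (f * g)"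
  using ideal.rcoset_mult_add[OF ideal_weyl_ideal, of f g q]
  by (simp add: weyl_algebra_def FactRing_def weyl_class_def ring_of_type_algebra_def)

lemma weyl_class_add:
  "weyl_class q f \<oplus>\<^bsub>weyl_algebra q\<^esub> weyl_class q g = weyl_class q (f + g)"
proof -
  interpret ideal "weyl_ideal q" ring_of_type_algebra
    by (rule ideal_weyl_ideal)
  show ?thesis
    using a_rcos_sum[of f g]
    by (simp add: weyl_algebra_def FactRing_def weyl_class_def ring_of_type_algebra_def)
qed

lemma weyl_class_smult:
  "c \<odot>\<^bsub>weyl_algebra q\<^esub> weyl_class q f = weyl_class q (free_const c * f)"
  using weyl_class_mult[of q "free_const c" f]
  by (simp add: weyl_algebra_def Let_def)

lemma weyl_one: "\<one>\<^bsub>weyl_algebra q\<^esub> = weyl_class q 1"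
  by (simp add: weyl_algebra_def FactRing_def weyl_class_def ring_of_type_algebra_def)

lemma weyl_zero: "\<zero>\<^bsub>weyl_algebra q\<^esub> = weyl_class q 0"
  by (auto simp: weyl_class_eq weyl_algebra_def FactRing_def)

text \<open>These push every operation of the quotient down to representatives, so the algebra laws
  are inherited from the free algebra.\<close>

lemmas weyl_class_simps =
  carrier_weyl_algebra weyl_class_mult weyl_class_add weyl_class_smult weyl_one weyl_zero

lemma free_const_mult: "free_const a * free_const b = free_const (a * b)"
  by (simp add: free_const_def mult_single)

lemma free_const_add: "free_const (a + b) = free_const a + free_const b"
  by (simp add: free_const_def single_add)

lemma free_const_one: "free_const 1 = 1"
  by (simp add: free_const_def)

lemma free_const_uminus: "free_const (- a) = - free_const a"
  by (simp add: free_const_def single_uminus)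

lemma free_const_commute: "f * free_const c = free_const c * f"
  by (induction f rule: poly_mapping_single_add_induct)
    (simp_all add: free_const_def mult_single distrib_left distrib_right mult.commute)

lemma free_const_left_commute: "f * (free_const c * g) = free_const c * (f * g)"
  by (metis free_const_commute mult.assoc)

lemma ring_weyl_algebra: "ring (weyl_algebra q)"
proof (rule ringI)
  show "abelian_group (weyl_algebra q)"
  proof (rule abelian_groupI)
    fix x assume "x \<in> carrier (weyl_algebra q)"
    then obtain f where "x = weyl_class q f"
      by (auto simp: weyl_class_simps)
    then have "weyl_class q (- f) \<oplus>\<^bsub>weyl_algebra q\<^esub> x = \<zero>\<^bsub>weyl_algebra q\<^esub>"
      by (simp add: weyl_class_simps)
    then show "\<exists>y\<in>carrier (weyl_algebra q). y \<oplus>\<^bsub>weyl_algebra q\<^esub> x = \<zero>\<^bsub>weyl_algebra q\<^esub>"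
      by (auto simp: weyl_class_simps)
  qed (auto simp: weyl_class_simps ac_simps)
qed (auto intro!: monoidI simp: weyl_class_simps mult.assoc distrib_left distrib_right)

lemma complex_algebra_weyl_algebra: "complex_algebra (weyl_algebra q)"
proof -
  interpret ring "weyl_algebra q"
    by (rule ring_weyl_algebra)
  have "a \<otimes>\<^bsub>weyl_algebra q\<^esub> (c \<odot>\<^bsub>weyl_algebra q\<^esub> b) = c \<odot>\<^bsub>weyl_algebra q\<^esub> (a \<otimes>\<^bsub>weyl_algebra q\<^esub> b)"
    if "a \<in> carrier (weyl_algebra q)" "b \<in> carrier (weyl_algebra q)" for a b c
    using that by (auto simp: weyl_class_simps free_const_left_commute)
  then show ?thesis
  proof (intro complex_algebra.intro complex_algebra_axioms.intro moduleI)
    show "cring (ring_of_type_algebra :: complex ring)" ..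
    show "abelian_group (weyl_algebra q)" ..
    show "ring (weyl_algebra q)" ..
  qed (auto simp: weyl_class_simps ring_of_type_algebra_def free_const_add free_const_one
      free_const_mult[symmetric] distrib_left distrib_right mult.assoc)
qed

section \<open>Parity automorphism, its square root, and the antihomomorphism on the free
  algebra\<close>

definition parity_sign :: "weyl_gen free_word \<Rightarrow> complex" where
  "parity_sign w = (if word_parity w = 1 then - 1 else 1)"

text \<open>A square root of the parity sign. It is not multiplicative: for two odd words the
  product of the roots is \<open>- 1\<close>, while the root of the even concatenation is 1. This
  defect produces the sign in the graded product law.\<close>

definition parity_root :: "weyl_gen free_word \<Rightarrow> complex" where
  "parity_root w = (if word_parity w = 1 then \<i> else 1)"

definition parity_aut :: "weyl_gen free_algebra \<Rightarrow> weyl_gen free_algebra" where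
  "parity_aut = twist (\<lambda>c. c) parity_sign (\<lambda>w. w)"

definition root_map :: "weyl_gen free_algebra \<Rightarrow> weyl_gen free_algebra" where
  "root_map = twist (\<lambda>c. c) parity_root (\<lambda>w. w)"

text \<open>The values on the odd generators are those of the involution times \<open>\<i>\<close>: then \<open>anti_map\<close> has no
  signs in its multiplication law, so that preimages of ideals are ideals.\<close>

fun star_coeff :: "complex \<Rightarrow> weyl_gen \<Rightarrow> complex" where
  "star_coeff q Gx = 1"
| "star_coeff q Gy = 1"
| "star_coeff q Gtheta = - \<i>"
| "star_coeff q Gdx = - (q powi -2)"
| "star_coeff q Gdy = - (q powi -4)"
| "star_coeff q Gdtheta = \<i> * q powi -4"

definition word_coeff :: "complex \<Rightarrow> weyl_gen free_word \<Rightarrow> complex" where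
  "word_coeff q w = prod_list (map (star_coeff q) (letters w))"

definition word_rev :: "'g free_word \<Rightarrow> 'g free_word" where
  "word_rev w = Free_Word (rev (letters w))"

definition anti_map :: "complex \<Rightarrow> weyl_gen free_algebra \<Rightarrow> weyl_gen free_algebra" where
  "anti_map q = twist cnj (word_coeff q) word_rev"

text \<open>The factor \<open>\<i>\<close> that \<open>root_map\<close> puts on odd words is
  conjugated by \<open>anti_map\<close> to \<open>- \<i>\<close>, which cancels the factor
  \<open>\<i>\<close> built into the values of \<open>star_coeff\<close> on the odd
  generators.\<close>

definition free_star :: "complex \<Rightarrow> weyl_gen free_algebra \<Rightarrow> weyl_gen free_algebra" where
  "free_star q f = anti_map q (root_map f)"

lemma word_parity_add: "word_parity (v + w) = word_parity v + word_parity w"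
  by (simp add: word_parity_def plus_free_word_def)

lemma parity_aut_mult: "parity_aut (f * g) = parity_aut f * parity_aut g"
  unfolding parity_aut_def
  by (rule ident.twist_mult) (auto simp: parity_sign_def word_parity_add)

lemma word_coeff_add: "word_coeff q (v + w) = word_coeff q v * word_coeff q w"
  by (simp add: word_coeff_def plus_free_word_def)

lemma word_rev_add: "word_rev (v + w) = word_rev w + word_rev v"
  by (simp add: word_rev_def plus_free_word_def)

lemma anti_map_mult: "anti_map q (f * g) = anti_map q g * anti_map q f"
  unfolding anti_map_def by (rule cnj.twist_mult_rev) (simp_all add: word_rev_add word_coeff_add)

lemmas parity_aut_single =
  ident.twist_single[of parity_sign "\<lambda>w. w", folded parity_aut_def]
lemmas root_map_single =
  ident.twist_single[of parity_root "\<lambda>w. w", folded root_map_def]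
lemmas anti_map_single =
  cnj.twist_single[of "word_coeff q" word_rev for q, folded anti_map_def]

interpretation parity_aut: Modules.additive parity_aut
  unfolding parity_aut_def by (rule ident.twist.additive_axioms)

interpretation root_map: Modules.additive root_map
  unfolding root_map_def by (rule ident.twist.additive_axioms)

interpretation anti_map: Modules.additive "anti_map q" for q
  unfolding anti_map_def by (rule cnj.twist.additive_axioms)

section \<open>Stability of the ideal of relations\<close>

lemma free_one_single: "(1 :: 'g free_algebra) = Poly_Mapping.single (Free_Word []) 1"
  by (simp flip: zero_free_word_def)

lemmas word_single_simps = free_var_def free_const_def zero_free_word_def plus_free_word_def
  mult_single free_one_single

text \<open>All words within one relation have the same parity, so the difference of its sides is an
  eigenvector with eigenvalue 1 or \<open>- 1\<close>.\<close>

lemma parity_aut_weyl_relation: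
  assumes "(l, r) \<in> weyl_relations q"
  shows "parity_aut (l - r) \<in> {l - r, - (l - r)}"
  using assms unfolding weyl_relations_def Let_def
  by (auto simp: parity_aut.diff parity_aut.add parity_aut.zero parity_aut_single
      word_single_simps distrib_left parity_sign_def word_parity_def gen_parity_def
      single_uminus)

text \<open>Reversal exchanges the two words of a two-term relation, which then only picks up a
  scalar. In the relations for \<open>dy * y\<close> and \<open>d\<theta> * \<theta>\<close> the
  extra terms \<open>x * dx\<close> and \<open>y * dy\<close> get reversed too, and bringing them
  back to normal order costs multiples of the relations for \<open>dx * x\<close> and
  \<open>dy * y\<close>.\<close>

lemma anti_map_weyl_relation:
  fixes q :: complex
  assumes q: "cmod q = 1" and "(l, r) \<in> weyl_relations q"
  shows "\<exists>a b c. anti_map q (l - r) =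
    free_const a * (l - r) +
    free_const b * (free_var Gdx * free_var Gx -
      (1 + free_const (q powi -2) * free_var Gx * free_var Gdx)) +
    free_const c * (free_var Gdy * free_var Gy -
      (1 + free_const (q powi -2) * free_var Gy * free_var Gdy +
        free_const (q powi -2 - 1) * free_var Gx * free_var Gdx))"
proof -
  have q0: "q \<noteq> 0"
    using q by auto
  \<comment> \<open>Unit modulus turns the conjugation of coefficients into inversion, so every
    coefficient comparison becomes an identity between powers of \<open>q\<close>.\<close>
  have cnj_q: "cnj q = inverse q"
    using q by (simp add: inverse_complex_def complex_eq_iff cmod_def field_simps)
  let ?x = "free_var Gx" and ?y = "free_var Gy" and ?\<theta> = "free_var Gtheta"
  let ?dx = "free_var Gdx" and ?dy = "free_var Gdy" and ?d\<theta> = "free_var Gdtheta"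
  let ?k = free_const
  let ?R = "\<lambda>l r. \<lambda>a b c. anti_map q (l - r) = ?k a * (l - r) +
    ?k b * (?dx * ?x - (1 + ?k (q powi -2) * ?x * ?dx)) +
    ?k c * (?dy * ?y - (1 + ?k (q powi -2) * ?y * ?dy + ?k (q powi -2 - 1) * ?x * ?dx))"
  note normalize = word_single_simps distrib_left distrib_right left_diff_distrib right_diff_distrib
    anti_map.diff anti_map.add anti_map.zero anti_map_single word_coeff_def word_rev_def
    cnj_q power_int_minus
  note compare = lookup_minus lookup_add lookup_single when_def q0 field_simps
  \<comment> \<open>The scalar \<open>a\<close> is found by comparing the words of the reversed
    relation with the original; \<open>b\<close> and \<open>c\<close> are the coefficients with
    which \<open>dx * x\<close> and \<open>dy * y\<close> arise from reversing the extra terms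
    \<open>x * dx\<close> and \<open>y * dy\<close>. They vanish in all other cases.\<close>
  have R:
    "?R (?x * ?y) (?y * ?x)
      (- 1) 0 0"
    "?R (?x * ?\<theta>) (?k q * ?\<theta> * ?x)
      (\<i> * inverse q) 0 0"
    "?R (?y * ?\<theta>) (?k q * ?\<theta> * ?y)
      (\<i> * inverse q) 0 0"
    "?R (?\<theta> * ?\<theta>) 0
      (- 1) 0 0"
    "?R (?dx * ?x) (1 + ?k (q powi -2) * ?x * ?dx)
      1 0 0"
    "?R (?dy * ?x) (?k (q powi -2) * ?x * ?dy)
      (inverse q ^ 2) 0 0"
    "?R (?d\<theta> * ?x) (?k (q powi -1) * ?x * ?d\<theta>)
      (- \<i> * inverse q ^ 3) 0 0"
    "?R (?dy * ?y) (1 + ?k (q powi -2) * ?y * ?dy + ?k (q powi -2 - 1) * ?x * ?dx)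
      (inverse q ^ 2) (1 - inverse q ^ 2) 0"
    "?R (?dx * ?y) (?y * ?dx)
      (inverse q ^ 2) 0 0"
    "?R (?d\<theta> * ?y) (?k (q powi -1) * ?y * ?d\<theta>)
      (- \<i> * inverse q ^ 3) 0 0"
    "?R (?d\<theta> * ?\<theta>) (1 - ?\<theta> * ?d\<theta> + ?k (q powi -2 - 1) * (?x * ?dx + ?y * ?dy))
      (inverse q ^ 4) (1 - inverse q ^ 2) (inverse q ^ 2 - inverse q ^ 4)"
    "?R (?dx * ?\<theta>) (?k (q powi -1) * ?\<theta> * ?dx)
      (- \<i> * inverse q) 0 0"
    "?R (?dy * ?\<theta>) (?k (q powi -1) * ?\<theta> * ?dy)
      (- \<i> * inverse q ^ 3) 0 0"
    "?R (?dx * ?dy) (?k (q powi -2) * ?dy * ?dx)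
      (- (inverse q ^ 4)) 0 0"
    "?R (?dx * ?d\<theta>) (?k (q powi -1) * ?d\<theta> * ?dx)
      (\<i> * inverse q ^ 5) 0 0"
    "?R (?dy * ?d\<theta>) (?k (q powi -1) * ?d\<theta> * ?dy)
      (\<i> * inverse q ^ 7) 0 0"
    "?R (?d\<theta> * ?d\<theta>) 0
      (- (inverse q ^ 8)) 0 0"
    \<comment> \<open>Both sides are expanded into single words and compared coefficient by
      coefficient.\<close>
    by (rule poly_mapping_eqI; simp add: normalize;
        auto simp: compare power2_eq_square eval_nat_numeral split: if_splits)+
  \<comment> \<open>Folding the existential into a predicate on pairs lets the finite set of
    relations be checked one element at a time.\<close>
  define Q where "Q l r \<longleftrightarrow> (\<exists>a b c. ?R l r a b c)" for l r
  have Q: "Q l r" if "?R l r a b c" for l r a b c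
    using that unfolding Q_def by blast
  have "\<forall>(l, r) \<in> weyl_relations q. Q l r"
    unfolding weyl_relations_def Let_def ball_simps(7) prod.case
    by (intro conjI ballI; (rule R[THEN Q] | elim emptyE))
  then show ?thesis
    using assms(2) unfolding Q_def by blast
qed

text \<open>The preimage of a two-sided ideal under an antihomomorphism is again one, with left and
  right absorption exchanged; by minimality it is enough that it contains the relations.\<close>

lemma anti_map_weyl_ideal:
  assumes q: "cmod q = 1" and "f \<in> weyl_ideal q"
  shows "anti_map q f \<in> weyl_ideal q"
proof -
  have rel: "anti_map q (l - r) \<in> weyl_ideal q" if lr: "(l, r) \<in> weyl_relations q" for l r
  proof -
    obtain a b c where "anti_map q (l - r) =
      free_const a * (l - r) +
      free_const b * (free_var Gdx * free_var Gx -
        (1 + free_const (q powi -2) * free_var Gx * free_var Gdx)) +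
      free_const c * (free_var Gdy * free_var Gy -
        (1 + free_const (q powi -2) * free_var Gy * free_var Gdy +
          free_const (q powi -2 - 1) * free_var Gx * free_var Gdx))"
      using anti_map_weyl_relation[OF q lr] by blast
    moreover have "free_var Gdx * free_var Gx -
        (1 + free_const (q powi -2) * free_var Gx * free_var Gdx) \<in> weyl_ideal q"
      by (rule weyl_relation_mem) (simp add: weyl_relations_def Let_def)
    moreover have "free_var Gdy * free_var Gy -
        (1 + free_const (q powi -2) * free_var Gy * free_var Gdy +
          free_const (q powi -2 - 1) * free_var Gx * free_var Gdx) \<in> weyl_ideal q"
      by (rule weyl_relation_mem) (simp add: weyl_relations_def Let_def)
    ultimately show ?thesis
      using weyl_relation_mem[OF lr] by (simp add: weyl_ideal_add weyl_ideal_mult_left)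
  qed
  have "weyl_ideal q \<subseteq> {f. anti_map q f \<in> weyl_ideal q}"
    by (rule weyl_ideal_least)
      (auto simp: anti_map.zero anti_map.add anti_map_mult rel
        intro: weyl_ideal_zero weyl_ideal_add weyl_ideal_mult_left weyl_ideal_mult_right)
  then show ?thesis
    using assms(2) by blast
qed

lemma parity_aut_weyl_ideal:
  assumes "f \<in> weyl_ideal q"
  shows "parity_aut f \<in> weyl_ideal q"
proof -
  have "parity_aut (l - r) \<in> weyl_ideal q" if "(l, r) \<in> weyl_relations q" for l r
    using parity_aut_weyl_relation[OF that] weyl_relation_mem[OF that]
      weyl_ideal_uminus[of "l - r" q] by auto
  then have "weyl_ideal q \<subseteq> {f. parity_aut f \<in> weyl_ideal q}"
    by (intro weyl_ideal_least)
      (auto simp: parity_aut.zero parity_aut.add parity_aut_mult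
        intro: weyl_ideal_zero weyl_ideal_add weyl_ideal_mult_left weyl_ideal_mult_right)
  then show ?thesis
    using assms by blast
qed

section \<open>The involution on the free algebra\<close>

lemma lookup_twist_diagonal:
  "Poly_Mapping.lookup (twist (\<lambda>c :: complex. c) h (\<lambda>w. w) f) v = h v * Poly_Mapping.lookup f v"
  by (induction f rule: poly_mapping_single_add_induct)
    (auto simp: ident.twist_single ident.twist_add lookup_single lookup_add when_def distrib_left)

lemma lookup_free_const_mult:
  "Poly_Mapping.lookup (free_const c * f) v = c * Poly_Mapping.lookup f v"
  by (induction f rule: poly_mapping_single_add_induct)
    (auto simp: free_const_def mult_single lookup_single lookup_add when_def distrib_left)

text \<open>The two scalars have sum 1 and difference \<open>\<i>\<close>, the factors on even and
  odd words. Although \<open>root_map\<close> is not multiplicative, it thereby preserves every left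
  ideal stable under \<open>parity_aut\<close>.\<close>

lemma root_map_eq:
  "root_map f = free_const ((1 + \<i>) / 2) * f + free_const ((1 - \<i>) / 2) * parity_aut f"
  by (rule poly_mapping_eqI)
    (simp add: root_map_def parity_aut_def lookup_twist_diagonal lookup_free_const_mult lookup_add
      parity_root_def parity_sign_def field_simps)

lemma free_star_weyl_ideal:
  assumes "cmod q = 1" "f \<in> weyl_ideal q"
  shows "free_star q f \<in> weyl_ideal q"
  unfolding free_star_def root_map_eq
  using assms
  by (intro anti_map_weyl_ideal weyl_ideal_add weyl_ideal_mult_left parity_aut_weyl_ideal)

interpretation free_star: Modules.additive "free_star q" for q
  by unfold_locales (simp add: free_star_def root_map.add anti_map.add)

text \<open>All coefficients are unimodular, which is what makes the second application of the
  involution undo the first.\<close>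

lemma star_coeff_cnj:
  assumes "cmod q = 1"
  shows "star_coeff q g * cnj (star_coeff q g) = 1"
proof -
  have "cmod (star_coeff q g) = 1"
    using assms by (cases g) (simp_all add: norm_mult norm_power_int)
  then show ?thesis
    by (simp add: complex_norm_square[symmetric])
qed

lemma word_coeff_rev: "word_coeff q (word_rev w) = word_coeff q w"
  by (simp add: word_coeff_def word_rev_def rev_map[symmetric])

lemma word_coeff_cnj:
  assumes "cmod q = 1"
  shows "word_coeff q w * cnj (word_coeff q w) = 1"
proof -
  have "prod_list (map (star_coeff q) gs) * cnj (prod_list (map (star_coeff q) gs)) = 1" for gs
  proof (induction gs)
    case (Cons g gs)
    then show ?case
      using star_coeff_cnj[OF assms, of g] by (simp add: mult_ac)
  qed simp
  then show ?thesis
    by (simp add: word_coeff_def)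
qed

lemma word_parity_rev: "word_parity (word_rev w) = word_parity w"
  by (simp add: word_parity_def word_rev_def rev_map[symmetric])

lemma free_star_single:
  "free_star q (Poly_Mapping.single w c) =
    Poly_Mapping.single (word_rev w) (word_coeff q w * cnj (parity_root w) * cnj c)"
  by (simp add: free_star_def root_map_single anti_map_single mult_ac)

text \<open>The coefficient of a word and its parity root are unchanged by reversal, so applying the
  map twice multiplies each word by a unimodular number times its own conjugate.\<close>

lemma free_star_free_star:
  assumes "cmod q = 1"
  shows "free_star q (free_star q f) = f"
proof (induction f rule: poly_mapping_single_add_induct)
  case (single w c)
  have "parity_root w * cnj (parity_root w) = 1"
    by (simp add: parity_root_def)
  moreover have "word_coeff q w * cnj (parity_root w) *
      cnj (word_coeff q w * cnj (parity_root w) * cnj c) =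
      (word_coeff q w * cnj (word_coeff q w)) * (parity_root w * cnj (parity_root w)) * c"
    by (simp add: mult_ac)
  ultimately have "word_coeff q w * cnj (parity_root w) *
      cnj (word_coeff q w * cnj (parity_root w) * cnj c) = c"
    using word_coeff_cnj[OF assms, of w] by simp
  moreover have "word_rev (word_rev w) = w" "parity_root (word_rev w) = parity_root w"
    by (simp_all add: word_rev_def parity_root_def word_parity_rev[unfolded word_rev_def])
  ultimately show ?case
    by (simp only: free_star_single word_coeff_rev)
qed (simp add: free_star.add)

lemma free_star_const_mult: "free_star q (free_const c * f) = free_const (cnj c) * free_star q f"
  by (induction f rule: poly_mapping_single_add_induct)
    (simp_all add: free_const_def mult_single free_star_single free_star.add distrib_left mult_ac)

section \<open>Homogeneous elements and the grading of the quotient\<close>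

definition homogeneous :: "bit \<Rightarrow> weyl_gen free_algebra \<Rightarrow> bool" where
  "homogeneous i f \<longleftrightarrow> (\<forall>w \<in> Poly_Mapping.keys f. word_parity w = i)"

lemma weyl_grading_eq: "weyl_grading q i = weyl_class q ` Collect (homogeneous i)"
  by (simp add: weyl_grading_def homogeneous_def[abs_def])

lemma homogeneous_mult:
  assumes "homogeneous i f" "homogeneous j g"
  shows "homogeneous (i + j) (f * g)"
  using assms keys_mult[of f g] by (fastforce simp: homogeneous_def word_parity_add)

lemma homogeneous_lookup:
  "homogeneous i f \<longleftrightarrow> (\<forall>w. word_parity w = i \<or> Poly_Mapping.lookup f w = 0)"
  by (auto simp: homogeneous_def in_keys_iff)

lemma homogeneous_zero: "homogeneous i 0"
  by (simp add: homogeneous_lookup)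

lemma homogeneous_one: "homogeneous 0 1"
  by (simp add: homogeneous_def word_parity_def zero_free_word_def)

lemma homogeneous_add: "homogeneous i f \<Longrightarrow> homogeneous i g \<Longrightarrow> homogeneous i (f + g)"
  by (auto simp: homogeneous_lookup lookup_add) (metis add.right_neutral)

lemma homogeneous_uminus: "homogeneous i f \<Longrightarrow> homogeneous i (- f)"
  by (simp add: homogeneous_lookup)

lemma homogeneous_const_mult: "homogeneous i f \<Longrightarrow> homogeneous i (free_const c * f)"
  by (auto simp: homogeneous_lookup lookup_free_const_mult)

lemma homogeneous_single: "homogeneous (word_parity w) (Poly_Mapping.single w c)"
  by (auto simp: homogeneous_lookup lookup_single when_def)

lemma twist_homogeneous:
  assumes "homogeneous i f" "\<And>w. word_parity w = i \<Longrightarrow> h w = c"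
  shows "twist (\<lambda>c. c) h (\<lambda>w. w) f = free_const c * f"
proof (rule poly_mapping_eqI)
  fix w
  show "Poly_Mapping.lookup (twist (\<lambda>c. c) h (\<lambda>w. w) f) w =
    Poly_Mapping.lookup (free_const c * f) w"
  proof (cases "word_parity w = i")
    case True
    then show ?thesis
      using assms(2) by (simp add: lookup_twist_diagonal lookup_free_const_mult)
  next
    case False
    then have "Poly_Mapping.lookup f w = 0"
      using assms(1) unfolding homogeneous_lookup by blast
    then show ?thesis
      by (simp add: lookup_twist_diagonal lookup_free_const_mult)
  qed
qed

lemma parity_aut_homogeneous:
  "homogeneous 0 f \<Longrightarrow> parity_aut f = f" "homogeneous 1 f \<Longrightarrow> parity_aut f = - f"
  using twist_homogeneous[of 0 f parity_sign 1] twist_homogeneous[of 1 f parity_sign "- 1"]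
  by (simp_all add: parity_aut_def parity_sign_def free_const_one free_const_uminus)

lemma root_map_homogeneous:
  "homogeneous i f \<Longrightarrow> root_map f = free_const (if i = 1 then \<i> else 1) * f"
  unfolding root_map_def by (rule twist_homogeneous) (auto simp: parity_root_def)

lemma homogeneous_decomp:
  obtains g h where "homogeneous 0 g" "homogeneous 1 h" "f = g + h"
proof
  \<comment> \<open>Twisting by the indicator of a parity is the projection onto the words of that
    parity.\<close>
  let ?P = "\<lambda>i. twist (\<lambda>c. c) (\<lambda>w. if word_parity w = i then 1 else 0) (\<lambda>w. w) f"
  show "homogeneous 0 (?P 0)" "homogeneous 1 (?P 1)"
    by (auto simp: homogeneous_lookup lookup_twist_diagonal)
  show "f = ?P 0 + ?P 1"
    by (rule poly_mapping_eqI) (auto simp: lookup_twist_diagonal lookup_add)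
qed

lemma anti_map_const_mult: "anti_map q (free_const c * f) = free_const (cnj c) * anti_map q f"
  by (induction f rule: poly_mapping_single_add_induct)
    (simp_all add: free_const_def mult_single anti_map_single anti_map.add distrib_left mult_ac)

lemma free_star_mult:
  assumes "homogeneous i f" "homogeneous j g"
  shows "free_star q (f * g) =
    free_const (if i = 1 \<and> j = 1 then - 1 else 1) * (free_star q g * free_star q f)"
proof -
  let ?e = "\<lambda>i :: bit. if i = 1 then \<i> else 1"
  have "free_star q (f * g) = free_const (cnj (?e (i + j))) * (anti_map q g * anti_map q f)"
    by (simp only: free_star_def root_map_homogeneous[OF homogeneous_mult[OF assms]]
        anti_map_const_mult anti_map_mult[of q f g])
  \<comment> \<open>Here the graded sign enters: \<open>anti_map\<close> reverses products without a
    sign, and the sign measures the failure of \<open>?e\<close> to be multiplicative.\<close>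
  also have "cnj (?e (i + j)) = (if i = 1 \<and> j = 1 then - 1 else 1) * (cnj (?e j) * cnj (?e i))"
    by (cases i; cases j) simp_all
  also have "free_const \<dots> * (anti_map q g * anti_map q f) =
    free_const (if i = 1 \<and> j = 1 then - 1 else 1) *
      ((free_const (cnj (?e j)) * anti_map q g) * (free_const (cnj (?e i)) * anti_map q f))"
    by (simp only: free_const_mult[symmetric] mult.assoc
        free_const_left_commute[of "anti_map q g"])
  finally show ?thesis
    by (simp only: free_star_def root_map_homogeneous[OF assms(1)]
        root_map_homogeneous[OF assms(2)] anti_map_const_mult)
qed

lemma weyl_class_uminus: "\<ominus>\<^bsub>weyl_algebra q\<^esub> weyl_class q f = weyl_class q (- f)"
proof -
  interpret ring "weyl_algebra q"
    by (rule ring_weyl_algebra)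
  show ?thesis
    by (rule minus_equality) (simp_all add: weyl_class_simps)
qed

text \<open>If the sum of an even \<open>u\<close> and an odd \<open>v\<close> lies in the ideal,
  then so does its image \<open>u - v\<close> under the parity automorphism. Adding, subtracting and
  halving put \<open>u\<close> and \<open>v\<close> themselves in the ideal.\<close>

lemma weyl_class_homogeneous_eq:
  assumes "homogeneous 0 g" "homogeneous 1 h" "homogeneous 0 g'" "homogeneous 1 h'"
    and "weyl_class q (g + h) = weyl_class q (g' + h')"
  shows "weyl_class q g = weyl_class q g'" "weyl_class q h = weyl_class q h'"
proof -
  let ?u = "g - g'" and ?v = "h - h'"
  have sum: "?u + ?v \<in> weyl_ideal q"
    using assms(5) by (simp add: weyl_class_eq_iff algebra_simps)
  then have "parity_aut (?u + ?v) \<in> weyl_ideal q"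
    by (rule parity_aut_weyl_ideal)
  then have diff: "?u - ?v \<in> weyl_ideal q"
    by (simp add: parity_aut.add parity_aut.diff parity_aut_homogeneous assms algebra_simps)
  have half: "free_const (1 / 2) * (f + f) = f" for f :: "weyl_gen free_algebra"
    by (simp add: distrib_left flip: distrib_right free_const_add) (simp add: free_const_one)
  have "(?u + ?v) + (?u - ?v) \<in> weyl_ideal q" "(?u + ?v) - (?u - ?v) \<in> weyl_ideal q"
    using sum diff by (blast intro: weyl_ideal_add weyl_ideal_diff)+
  moreover have "(?u + ?v) + (?u - ?v) = ?u + ?u" "(?u + ?v) - (?u - ?v) = ?v + ?v"
    by simp_all
  ultimately have "?u \<in> weyl_ideal q" "?v \<in> weyl_ideal q"
    using weyl_ideal_mult_left[of _ q "free_const (1 / 2)"] by (metis half)+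
  then show "weyl_class q g = weyl_class q g'" "weyl_class q h = weyl_class q h'"
    by (simp_all add: weyl_class_eq_iff)
qed

lemma Z2_graded_algebra_weyl_algebra: "Z2_graded_algebra (weyl_algebra q) (weyl_grading q)"
proof -
  interpret complex_algebra "weyl_algebra q"
    by (rule complex_algebra_weyl_algebra)
  show ?thesis
  proof (intro Z2_graded_algebra.intro Z2_graded_algebra_axioms.intro
      complex_algebra_weyl_algebra)
    fix i
    show "submodule (weyl_grading q i) ring_of_type_algebra (weyl_algebra q)"
      by (rule submoduleI)
        (auto simp: weyl_grading_eq weyl_class_simps weyl_class_uminus
          intro: homogeneous_zero homogeneous_uminus homogeneous_add homogeneous_const_mult)
  next
    fix a assume "a \<in> carrier (weyl_algebra q)"
    then obtain g h where gh: "homogeneous 0 g" "homogeneous 1 h" "a = weyl_class q (g + h)"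
      unfolding carrier_weyl_algebra using homogeneous_decomp by (metis imageE)
    show "\<exists>!(u, v). u \<in> weyl_grading q 0 \<and> v \<in> weyl_grading q 1 \<and> a = u \<oplus>\<^bsub>weyl_algebra q\<^esub> v"
    proof (rule ex1I[of _ "(weyl_class q g, weyl_class q h)"])
      show "case (weyl_class q g, weyl_class q h) of (u, v) \<Rightarrow>
        u \<in> weyl_grading q 0 \<and> v \<in> weyl_grading q 1 \<and> a = u \<oplus>\<^bsub>weyl_algebra q\<^esub> v"
        using gh by (auto simp: weyl_grading_eq weyl_class_simps)
    next
      fix uv
      assume "case uv of (u, v) \<Rightarrow>
        u \<in> weyl_grading q 0 \<and> v \<in> weyl_grading q 1 \<and> a = u \<oplus>\<^bsub>weyl_algebra q\<^esub> v"
      then obtain g' h' where "uv = (weyl_class q g', weyl_class q h')" "homogeneous 0 g'"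
        "homogeneous 1 h'" "a = weyl_class q (g' + h')"
        by (auto simp: weyl_grading_eq weyl_class_add)
      then show "uv = (weyl_class q g, weyl_class q h)"
        using weyl_class_homogeneous_eq[of g' h' g h q] gh by simp
    qed
  next
    fix a b i j
    assume "a \<in> weyl_grading q i" "b \<in> weyl_grading q j"
    then show "a \<otimes>\<^bsub>weyl_algebra q\<^esub> b \<in> weyl_grading q (i + j)"
      unfolding weyl_grading_eq
      by (elim imageE, simp only: weyl_class_mult mem_Collect_eq)
        (intro imageI CollectI homogeneous_mult)
  qed
qed

section \<open>The involution on the quotient\<close>

text \<open>The restriction to the carrier fixes the values elsewhere, as uniqueness among
  extensional functions demands. The choice of representative is immaterial by the next
  lemma.\<close>

definition weyl_star ::
  "complex \<Rightarrow> weyl_gen free_algebra set \<Rightarrow> weyl_gen free_algebra set" where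
  "weyl_star q = (\<lambda>a \<in> carrier (weyl_algebra q).
    weyl_class q (free_star q (SOME f. weyl_class q f = a)))"

text \<open>\<open>free_star\<close> is additive and preserves the ideal, so two representatives of
  one class have images in one class.\<close>

lemma weyl_star_class:
  assumes "cmod q = 1"
  shows "weyl_star q (weyl_class q f) = weyl_class q (free_star q f)"
proof -
  have "weyl_class q (SOME g. weyl_class q g = weyl_class q f) = weyl_class q f"
    by (rule someI) (rule refl)
  then show ?thesis
    using free_star_weyl_ideal[OF assms]
    by (auto simp: weyl_star_def carrier_weyl_algebra weyl_class_eq_iff simp flip: free_star.diff)
qed

lemma Z2_graded_star_algebra_weyl_star:
  assumes "cmod q = 1"
  shows "Z2_graded_star_algebra (weyl_algebra q) (weyl_grading q) (weyl_star q)"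
proof (intro Z2_graded_star_algebra.intro Z2_graded_star_algebra_axioms.intro
    Z2_graded_algebra_weyl_algebra)
  fix a b i j
  assume "a \<in> weyl_grading q i" "b \<in> weyl_grading q j"
  then obtain f g where "homogeneous i f" "homogeneous j g" "a = weyl_class q f" "b = weyl_class q g"
    by (auto simp only: weyl_grading_eq)
  then show "weyl_star q (a \<otimes>\<^bsub>weyl_algebra q\<^esub> b) = (if i = 1 \<and> j = 1 then -1 else 1)
      \<odot>\<^bsub>weyl_algebra q\<^esub> (weyl_star q b \<otimes>\<^bsub>weyl_algebra q\<^esub> weyl_star q a)"
    by (simp only: weyl_class_mult weyl_class_smult weyl_star_class[OF assms] free_star_mult)
qed (auto simp: carrier_weyl_algebra weyl_class_add weyl_class_smult weyl_star_class[OF assms]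
    free_star.add free_star_const_mult free_star_free_star[OF assms])

section \<open>Uniqueness of the involution\<close>

lemma (in Z2_graded_star_algebra) star_one:
  assumes "\<one>\<^bsub>A\<^esub> \<in> gr 0"
  shows "star \<one>\<^bsub>A\<^esub> = \<one>\<^bsub>A\<^esub>"
proof -
  have gr_carrier: "a \<in> carrier A" if "a \<in> gr i" for a i
    using submoduleE(1)[OF gr_submodule] that by blast
  have smult_1: "1 \<odot>\<^bsub>A\<^esub> a = a" if "a \<in> carrier A" for a
    using smult_one[OF that] by (simp add: ring_of_type_algebra_def)
  \<comment> \<open>This is the involution applied to the product of the unit with \<open>a\<close>.
    The product law speaks of homogeneous elements only, so the general case goes through the two
    components of \<open>a\<close>.\<close>
  have hom: "star a = star a \<otimes>\<^bsub>A\<^esub> star \<one>\<^bsub>A\<^esub>" if "a \<in> gr i" for a i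
    using star_mult[OF assms that] gr_carrier[OF that]
    by (simp add: smult_1 star_closed)
  have "star a = star a \<otimes>\<^bsub>A\<^esub> star \<one>\<^bsub>A\<^esub>" if a: "a \<in> carrier A" for a
  proof -
    obtain u v where uv: "u \<in> gr 0" "v \<in> gr 1" "a = u \<oplus>\<^bsub>A\<^esub> v"
      using gr_direct_sum[OF a] by blast
    then show ?thesis
      using hom[OF uv(1)] hom[OF uv(2)] gr_carrier
      by (simp add: star_add star_closed l_distr)
  qed
  \<comment> \<open>For this element the left factor on the right-hand side is the double star of
    the unit, that is, the unit.\<close>
  from this[of "star \<one>\<^bsub>A\<^esub>"] show ?thesis
    by (simp add: star_closed star_star)
qed

text \<open>Generators are homogeneous and so are words, hence the graded product law determines
  both maps on words letter by letter, starting from the unit; conjugate-linearity and additivity do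
  the rest.\<close>

lemma weyl_star_unique:
  assumes s: "Z2_graded_star_algebra (weyl_algebra q) (weyl_grading q) s"
    and t: "Z2_graded_star_algebra (weyl_algebra q) (weyl_grading q) t"
    and gen: "\<And>g. s (weyl_var q g) = t (weyl_var q g)"
  shows "s (weyl_class q f) = t (weyl_class q f)"
proof -
  interpret s: Z2_graded_star_algebra "weyl_algebra q" "weyl_grading q" s by (rule s)
  interpret t: Z2_graded_star_algebra "weyl_algebra q" "weyl_grading q" t by (rule t)
  have "\<one>\<^bsub>weyl_algebra q\<^esub> \<in> weyl_grading q 0"
    using homogeneous_one by (auto simp: weyl_grading_eq weyl_one)
  then have one: "s (weyl_class q 1) = t (weyl_class q 1)"
    using s.star_one t.star_one by (simp add: weyl_one)
  have word: "s (weyl_class q (Poly_Mapping.single (Free_Word gs) 1)) =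
    t (weyl_class q (Poly_Mapping.single (Free_Word gs) 1))" for gs
  proof (induction gs)
    case Nil
    show ?case
      using one by (simp add: free_one_single)
  next
    case (Cons g gs)
    let ?w = "Poly_Mapping.single (Free_Word gs) 1 :: weyl_gen free_algebra"
    have split: "weyl_class q (Poly_Mapping.single (Free_Word (g # gs)) 1) =
      weyl_var q g \<otimes>\<^bsub>weyl_algebra q\<^esub> weyl_class q ?w"
      by (simp add: weyl_var_def weyl_class_simps free_var_def mult_single plus_free_word_def)
    have "weyl_var q g \<in> weyl_grading q (word_parity (Free_Word [g]))"
      "weyl_class q ?w \<in> weyl_grading q (word_parity (Free_Word gs))"
      using homogeneous_single by (auto simp: weyl_grading_eq weyl_var_def free_var_def)
    from s.star_mult[OF this] t.star_mult[OF this] show ?case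
      unfolding split by (simp add: gen Cons.IH)
  qed
  show ?thesis
  proof (induction f rule: poly_mapping_single_add_induct)
    case (single w c)
    have "weyl_class q (Poly_Mapping.single w c) =
      c \<odot>\<^bsub>weyl_algebra q\<^esub> weyl_class q (Poly_Mapping.single (Free_Word (letters w)) 1)"
      by (simp add: weyl_class_simps free_const_def mult_single)
    then show ?case
      using word[of "letters w"] by (simp add: s.star_smult t.star_smult carrier_weyl_algebra)
  next
    case (add f g)
    then show ?case
      using s.star_add[of "weyl_class q f" "weyl_class q g"]
        t.star_add[of "weyl_class q f" "weyl_class q g"]
      by (simp add: weyl_class_simps)
  qed
qed

text \<open>The factor \<open>- \<i>\<close> on odd generators is the conjugate of their parity
  root.\<close>

lemma weyl_star_var:
  assumes "cmod q = 1"
  shows "weyl_star q (weyl_var q g) =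
    (star_coeff q g * (if gen_parity g = 1 then - \<i> else 1)) \<odot>\<^bsub>weyl_algebra q\<^esub> weyl_var q g"
  by (simp add: weyl_var_def weyl_star_class[OF assms] free_var_def free_star_single
      weyl_class_smult free_const_def mult_single word_rev_def word_coeff_def parity_root_def
      word_parity_def)

theorem theorem4p36:
  fixes q :: complex
  assumes "cmod q = 1"
  shows "Z2_graded_algebra (weyl_algebra q) (weyl_grading q) \<and>
    (\<exists>!star. star \<in> extensional (carrier (weyl_algebra q)) \<and>
      Z2_graded_star_algebra (weyl_algebra q) (weyl_grading q) star \<and>
      star (weyl_var q Gx) = weyl_var q Gx \<and>
      star (weyl_var q Gy) = weyl_var q Gy \<and>
      star (weyl_var q Gtheta) = (-1) \<odot>\<^bsub>weyl_algebra q\<^esub> weyl_var q Gtheta \<and>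
      star (weyl_var q Gdx) = (- (q powi -2)) \<odot>\<^bsub>weyl_algebra q\<^esub> weyl_var q Gdx \<and>
      star (weyl_var q Gdy) = (- (q powi -4)) \<odot>\<^bsub>weyl_algebra q\<^esub> weyl_var q Gdy \<and>
      star (weyl_var q Gdtheta) = (q powi -4) \<odot>\<^bsub>weyl_algebra q\<^esub> weyl_var q Gdtheta)"
proof (intro conjI Z2_graded_algebra_weyl_algebra ex1I[of _ "weyl_star q"]; (elim conjE)?)
  have smult_1: "1 \<odot>\<^bsub>weyl_algebra q\<^esub> weyl_var q g = weyl_var q g" for g
    by (simp add: weyl_var_def weyl_class_smult free_const_one)
  note var = weyl_star_var[OF assms]
  show "weyl_star q \<in> extensional (carrier (weyl_algebra q))"
    by (simp add: weyl_star_def)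
  show star: "Z2_graded_star_algebra (weyl_algebra q) (weyl_grading q) (weyl_star q)"
    by (rule Z2_graded_star_algebra_weyl_star[OF assms])
  show gens: "weyl_star q (weyl_var q Gx) = weyl_var q Gx"
    "weyl_star q (weyl_var q Gy) = weyl_var q Gy"
    "weyl_star q (weyl_var q Gtheta) = (-1) \<odot>\<^bsub>weyl_algebra q\<^esub> weyl_var q Gtheta"
    "weyl_star q (weyl_var q Gdx) = (- (q powi -2)) \<odot>\<^bsub>weyl_algebra q\<^esub> weyl_var q Gdx"
    "weyl_star q (weyl_var q Gdy) = (- (q powi -4)) \<odot>\<^bsub>weyl_algebra q\<^esub> weyl_var q Gdy"
    "weyl_star q (weyl_var q Gdtheta) = (q powi -4) \<odot>\<^bsub>weyl_algebra q\<^esub> weyl_var q Gdtheta"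
    by (simp_all add: var gen_parity_def smult_1 mult_ac)
  fix s
  assume ext: "s \<in> extensional (carrier (weyl_algebra q))"
    and s: "Z2_graded_star_algebra (weyl_algebra q) (weyl_grading q) s"
    and s_gens: "s (weyl_var q Gx) = weyl_var q Gx"
      "s (weyl_var q Gy) = weyl_var q Gy"
      "s (weyl_var q Gtheta) = (-1) \<odot>\<^bsub>weyl_algebra q\<^esub> weyl_var q Gtheta"
      "s (weyl_var q Gdx) = (- (q powi -2)) \<odot>\<^bsub>weyl_algebra q\<^esub> weyl_var q Gdx"
      "s (weyl_var q Gdy) = (- (q powi -4)) \<odot>\<^bsub>weyl_algebra q\<^esub> weyl_var q Gdy"
      "s (weyl_var q Gdtheta) = (q powi -4) \<odot>\<^bsub>weyl_algebra q\<^esub> weyl_var q Gdtheta"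
  have "s (weyl_var q g) = weyl_star q (weyl_var q g)" for g
    by (cases g) (simp_all only: s_gens gens)
  then have "s (weyl_class q f) = weyl_star q (weyl_class q f)" for f
    by (rule weyl_star_unique[OF s star])
  \<comment> \<open>Off the carrier both functions take the default value of extensional functions,
    so agreement on classes is enough.\<close>
  then show "s = weyl_star q"
    by (intro extensionalityI[OF ext]) (auto simp: weyl_star_def carrier_weyl_algebra)
qed

end
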